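(* Let $(M,g)$ be a Lorentzian manifold of dimension $n\ge 2$, let $\{V,-V\}$ be a smooth non-vanishing line element field on $M$ with $g(V,V)=-1$, let $f\colon M\to\mathbb R$ be smooth, and let $\tilde g=g+f\,V^\flat\otimes V^\flat$ be the resulting signature-type changing metric, with $\mathcal H=\{q\in M:\tilde g|_q\text{ is degenerate}\}$. If $q\in\mathcal H$, then $\tilde g(x,x)>0$ for all $x\in T_qM$ with $x\notin\mathrm{Rad}_q$.
   Context: Lorentzian metrics have signature $(-,+,\ldots,+)$. A smooth non-vanishing line element field is a smooth assignment to each $p\in M$ of an unordered pair $\{V_p,-V_p\}$ of opposite nonzero tangent vectors. $V^\flat=g(V,\cdot)$ is taken with respect to $g$, so $V^\flat\otimes V^\flat$ is independent of the choice of sign. For $q\in\mathcal H$, $\mathrm{Rad}_q=\{w\in T_qM:\tilde g(w,\cdot)=0\}$. *)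

theory Defs
  imports "HOL-Analysis.Analysis" "HOL-Library.Function_Algebras"
begin

subsection \<open>Pointwise real vector space structure on functions\<close>

text \<open>Tangent vectors below are functionals on functions; the instance makes the library notions
  \<^term>\<open>subspace\<close>, \<^term>\<open>independent\<close> and \<^term>\<open>span\<close> available for them.\<close>

instantiation "fun" :: (type, real_vector) real_vector
begin

definition scaleR_fun :: "real \<Rightarrow> ('a \<Rightarrow> 'b) \<Rightarrow> 'a \<Rightarrow> 'b" where
  "scaleR_fun c F = (\<lambda>x. c *\<^sub>R F x)"

instance
  by standard (auto simp: scaleR_fun_def fun_eq_iff scaleR_add_right scaleR_add_left)

end

subsection \<open>Smooth maps between Euclidean spaces\<close>

text \<open>Only used for open \<open>S\<close>, where \<^term>\<open>Ck_on k S F\<close> says that \<open>F\<close> is of class \<open>C\<^sup>k\<close> on \<open>S\<close>.\<close>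

primrec Ck_on :: "nat \<Rightarrow> 'a::euclidean_space set \<Rightarrow> ('a \<Rightarrow> 'b::real_normed_vector) \<Rightarrow> bool" where
  "Ck_on 0 S F \<longleftrightarrow> continuous_on S F"
| "Ck_on (Suc k) S F \<longleftrightarrow>
     (\<forall>x\<in>S. F differentiable at x) \<and> (\<forall>v. Ck_on k S (\<lambda>x. frechet_derivative F (at x) v))"

definition smooth_on :: "'a::euclidean_space set \<Rightarrow> ('a \<Rightarrow> 'b::real_normed_vector) \<Rightarrow> bool" where
  "smooth_on S F \<longleftrightarrow> (\<forall>k. Ck_on k S F)"

subsection \<open>Smooth manifolds\<close>

text \<open>The underlying topological space is \<open>X\<close>, with point set \<^term>\<open>topspace X\<close>. The dimension is
  \<open>CARD('n)\<close>. Only the values of \<open>\<phi>\<close> on \<open>U\<close> matter in a chart \<open>(U, \<phi>)\<close>; its inverse is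
  \<^term>\<open>inv_into U \<phi>\<close>. The atlas need not be maximal.\<close>

type_synonym ('a, 'n) chart = "'a set \<times> ('a \<Rightarrow> real ^ 'n)"

definition is_chart :: "'a topology \<Rightarrow> ('a, 'n::finite) chart \<Rightarrow> bool" where
  "is_chart X = (\<lambda>(U, \<phi>). openin X U \<and> open (\<phi> ` U) \<and>
     homeomorphic_map (subtopology X U) (top_of_set (\<phi> ` U)) \<phi>)"

definition smooth_atlas :: "'a topology \<Rightarrow> ('a, 'n::finite) chart set \<Rightarrow> bool" where
  "smooth_atlas X A \<longleftrightarrow>
     (\<forall>c\<in>A. is_chart X c) \<and> (\<Union>c\<in>A. fst c) = topspace X \<and>
     (\<forall>(U, \<phi>)\<in>A. \<forall>(W, \<psi>)\<in>A. smooth_on (\<phi> ` (U \<inter> W)) (\<psi> \<circ> inv_into U \<phi>))"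

definition smooth_manifold :: "'a topology \<Rightarrow> ('a, 'n::finite) chart set \<Rightarrow> bool" where
  "smooth_manifold X A \<longleftrightarrow> Hausdorff_space X \<and> second_countable X \<and> smooth_atlas X A"

text \<open>Smoothness of a real function on the open subset \<open>W\<close> of the manifold.\<close>

definition smooth_fun_on :: "('a, 'n::finite) chart set \<Rightarrow> 'a set \<Rightarrow> ('a \<Rightarrow> real) \<Rightarrow> bool" where
  "smooth_fun_on A W h \<longleftrightarrow> (\<forall>(U, \<phi>)\<in>A. smooth_on (\<phi> ` (U \<inter> W)) (h \<circ> inv_into U \<phi>))"

abbreviation smooth_fun :: "'a topology \<Rightarrow> ('a, 'n::finite) chart set \<Rightarrow> ('a \<Rightarrow> real) \<Rightarrow> bool" where
  "smooth_fun X A h \<equiv> smooth_fun_on A (topspace X) h"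

subsection \<open>Tangent vectors\<close>

text \<open>Tangent vectors are derivations of the algebra of smooth functions; they are extended by \<open>0\<close>
  to non-smooth functions, so that equality of tangent vectors is equality of functionals.\<close>

type_synonym 'a tvec = "('a \<Rightarrow> real) \<Rightarrow> real"

definition tangent_space :: "'a topology \<Rightarrow> ('a, 'n::finite) chart set \<Rightarrow> 'a \<Rightarrow> 'a tvec set" where
  "tangent_space X A p = {v.
     (\<forall>h k a b. smooth_fun X A h \<longrightarrow> smooth_fun X A k \<longrightarrow>
        v (\<lambda>x. a * h x + b * k x) = a * v h + b * v k) \<and>
     (\<forall>h k. smooth_fun X A h \<longrightarrow> smooth_fun X A k \<longrightarrow>
        v (\<lambda>x. h x * k x) = h p * v k + k p * v h) \<and>
     (\<forall>h. \<not> smooth_fun X A h \<longrightarrow> v h = 0)}"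

text \<open>The coordinate vector \<open>\<partial>\<^sub>i\<close> of the chart \<open>(U, \<phi>)\<close> at \<open>p \<in> U\<close>.\<close>

definition coord_vec ::
  "'a topology \<Rightarrow> ('a, 'n::finite) chart set \<Rightarrow> ('a, 'n) chart \<Rightarrow> 'n \<Rightarrow> 'a \<Rightarrow> 'a tvec" where
  "coord_vec X A = (\<lambda>(U, \<phi>) i p h.
     if smooth_fun X A h
     then frechet_derivative (h \<circ> inv_into U \<phi>) (at (\<phi> p)) (axis i 1) else 0)"

text \<open>A smooth vector field on the open subset \<open>W\<close>: its coordinate components are smooth.\<close>

definition smooth_vector_field_on ::
  "'a topology \<Rightarrow> ('a, 'n::finite) chart set \<Rightarrow> 'a set \<Rightarrow> ('a \<Rightarrow> 'a tvec) \<Rightarrow> bool" where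
  "smooth_vector_field_on X A W V \<longleftrightarrow>
     (\<forall>p\<in>W. V p \<in> tangent_space X A p) \<and>
     (\<forall>(U, \<phi>)\<in>A. \<exists>a :: 'n \<Rightarrow> 'a \<Rightarrow> real.
        (\<forall>i. smooth_on (\<phi> ` (U \<inter> W)) (a i \<circ> inv_into U \<phi>)) \<and>
        (\<forall>p\<in>U \<inter> W. V p = (\<Sum>i\<in>UNIV. a i p *\<^sub>R coord_vec X A (U, \<phi>) i p)))"

subsection \<open>Lorentzian metrics\<close>

definition sym_bilinear_on :: "'v::real_vector set \<Rightarrow> ('v \<Rightarrow> 'v \<Rightarrow> real) \<Rightarrow> bool" where
  "sym_bilinear_on T B \<longleftrightarrow>
     (\<forall>x\<in>T. \<forall>y\<in>T. B x y = B y x) \<and>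
     (\<forall>x\<in>T. \<forall>y\<in>T. \<forall>z\<in>T. \<forall>a b. B (a *\<^sub>R x + b *\<^sub>R y) z = a * B x z + b * B y z)"

text \<open>Signature \<open>(-,+,\<dots>,+)\<close>: there is a basis of \<open>T\<close>, indexed by \<open>'n\<close>, in which the matrix of \<open>B\<close> is
  diagonal with one entry \<open>-1\<close> (at some index \<open>i0\<close>) and all other diagonal entries \<open>1\<close>.\<close>

definition lorentz_signature_on ::
  "'n::finite itself \<Rightarrow> 'v::real_vector set \<Rightarrow> ('v \<Rightarrow> 'v \<Rightarrow> real) \<Rightarrow> bool" where
  "lorentz_signature_on _ T B \<longleftrightarrow> (\<exists>(e :: 'n \<Rightarrow> 'v) i0.
     inj e \<and> independent (range e) \<and> span (range e) = T \<and>
     (\<forall>i j. B (e i) (e j) = (if i \<noteq> j then 0 else if i = i0 then -1 else 1)))"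

type_synonym 'a tensor2 = "'a \<Rightarrow> 'a tvec \<Rightarrow> 'a tvec \<Rightarrow> real"

definition smooth_tensor2 :: "'a topology \<Rightarrow> ('a, 'n::finite) chart set \<Rightarrow> 'a tensor2 \<Rightarrow> bool" where
  "smooth_tensor2 X A g \<longleftrightarrow> (\<forall>(U, \<phi>)\<in>A. \<forall>i j. smooth_on (\<phi> ` U)
     ((\<lambda>p. g p (coord_vec X A (U, \<phi>) i p) (coord_vec X A (U, \<phi>) j p)) \<circ> inv_into U \<phi>))"

definition lorentzian_metric :: "'a topology \<Rightarrow> ('a, 'n::finite) chart set \<Rightarrow> 'a tensor2 \<Rightarrow> bool" where
  "lorentzian_metric X A g \<longleftrightarrow>
     (\<forall>p\<in>topspace X. sym_bilinear_on (tangent_space X A p) (g p) \<and>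
        lorentz_signature_on TYPE('n) (tangent_space X A p) (g p)) \<and>
     smooth_tensor2 X A g"

definition lorentzian_manifold :: "'a topology \<Rightarrow> ('a, 'n::finite) chart set \<Rightarrow> 'a tensor2 \<Rightarrow> bool" where
  "lorentzian_manifold X A g \<longleftrightarrow> smooth_manifold X A \<and> lorentzian_metric X A g"

subsection \<open>Line element fields and the modified metric\<close>

text \<open>Smoothness of \<open>p \<mapsto> {V\<^sub>p, -V\<^sub>p}\<close>: locally the pair is represented by a smooth vector field.
  No global choice of sign is assumed to exist.\<close>

definition line_element_field ::
  "'a topology \<Rightarrow> ('a, 'n::finite) chart set \<Rightarrow> ('a \<Rightarrow> 'a tvec set) \<Rightarrow> bool" where
  "line_element_field X A L \<longleftrightarrow>
     (\<forall>p\<in>topspace X. \<exists>v\<in>tangent_space X A p. v \<noteq> 0 \<and> L p = {v, - v}) \<and>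
     (\<forall>p\<in>topspace X. \<exists>W V. openin X W \<and> p \<in> W \<and> smooth_vector_field_on X A W V \<and>
        (\<forall>x\<in>W. L x = {V x, - V x}))"

text \<open>The tensor \<open>V\<^sup>\<flat> \<otimes> V\<^sup>\<flat>\<close>, evaluated with an arbitrary representative of the pair;
  see \<open>flat_square_eq\<close> for independence of that choice.\<close>

definition flat_square :: "'a tensor2 \<Rightarrow> ('a \<Rightarrow> 'a tvec set) \<Rightarrow> 'a tensor2" where
  "flat_square g L p x y = (let v = (SOME v. v \<in> L p) in g p v x * g p v y)"

definition modified_metric ::
  "'a tensor2 \<Rightarrow> ('a \<Rightarrow> real) \<Rightarrow> ('a \<Rightarrow> 'a tvec set) \<Rightarrow> 'a tensor2" where
  "modified_metric g f L p x y = g p x y + f p * flat_square g L p x y"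

definition Rad :: "'a topology \<Rightarrow> ('a, 'n::finite) chart set \<Rightarrow> 'a tensor2 \<Rightarrow> 'a \<Rightarrow> 'a tvec set" where
  "Rad X A t p = {w \<in> tangent_space X A p. \<forall>y\<in>tangent_space X A p. t p w y = 0}"

definition degenerate_at :: "'a topology \<Rightarrow> ('a, 'n::finite) chart set \<Rightarrow> 'a tensor2 \<Rightarrow> 'a \<Rightarrow> bool" where
  "degenerate_at X A t p \<longleftrightarrow>
     (\<exists>w\<in>tangent_space X A p. w \<noteq> 0 \<and> (\<forall>y\<in>tangent_space X A p. t p w y = 0))"

definition degeneracy_locus :: "'a topology \<Rightarrow> ('a, 'n::finite) chart set \<Rightarrow> 'a tensor2 \<Rightarrow> 'a set" where
  "degeneracy_locus X A t = {p \<in> topspace X. degenerate_at X A t p}"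

lemma flat_square_eq:
  fixes A :: "('a, 'n::finite) chart set"
  assumes g: "lorentzian_metric X A g" and L: "line_element_field X A L"
    and p: "p \<in> topspace X" and v: "v \<in> L p"
    and x: "x \<in> tangent_space X A p" and y: "y \<in> tangent_space X A p"
  shows "flat_square g L p x y = g p v x * g p v y"
proof -
  obtain u where u: "u \<in> tangent_space X A p" "L p = {u, - u}"
    using L p unfolding line_element_field_def by blast
  have B: "sym_bilinear_on (tangent_space X A p) (g p)"
    using g p unfolding lorentzian_metric_def by blast
  have neg: "g p (- u) z = - g p u z" if z: "z \<in> tangent_space X A p" for z
  proof -
    have "g p ((-1) *\<^sub>R u + 0 *\<^sub>R u) z = (-1) * g p u z + 0 * g p u z"
      using B u(1) z unfolding sym_bilinear_on_def by blast
    then show ?thesis by simp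
  qed
  have eq: "g p w x * g p w y = g p u x * g p u y" if "w \<in> L p" for w
    using that u(2) neg[OF x] neg[OF y] by auto
  have "(SOME w. w \<in> L p) \<in> L p" by (rule someI[of "\<lambda>w. w \<in> L p", OF v])
  from eq[OF this] eq[OF v] show ?thesis unfolding flat_square_def Let_def by simp
qed

end

theory Submission
  imports Defs
begin

text \<open>Fix \<open>q\<close>, write \<open>v\<close> for a representative of the line element and \<open>c = f q\<close>. Testing a null vector
  \<open>w\<close> of \<open>g + c v\<^sup>\<flat> \<otimes> v\<^sup>\<flat>\<close> against \<open>v\<close> gives \<open>(1 - c) g(v, w) = 0\<close>; nondegeneracy of \<open>g\<close> excludes
  \<open>g(v, w) = 0\<close>, so \<open>c = 1\<close>. The modified form then sends \<open>x\<close> to \<open>g(z, z)\<close>, where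
  \<open>z = x + g(v, x) v\<close> is the \<open>g\<close>-orthogonal projection of \<open>x\<close> to the complement of \<open>v\<close>, on which
  \<open>g\<close> is positive definite.\<close>

lemma sym_bilinear_on_commute:
  assumes "sym_bilinear_on T B" "x \<in> T" "y \<in> T"
  shows "B x y = B y x"
  using assms unfolding sym_bilinear_on_def by blast

lemma sym_bilinear_on_combination_left:
  assumes "sym_bilinear_on T B" "x \<in> T" "y \<in> T" "z \<in> T"
  shows "B (a *\<^sub>R x + b *\<^sub>R y) z = a * B x z + b * B y z"
  using assms unfolding sym_bilinear_on_def by blast

lemma sym_bilinear_on_scaleR_left:
  assumes "sym_bilinear_on T B" "x \<in> T" "z \<in> T"
  shows "B (a *\<^sub>R x) z = a * B x z"
  using sym_bilinear_on_combination_left[of T B x x z a 0] assms by simp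

lemma sym_bilinear_on_sum_left:
  assumes B: "sym_bilinear_on T B" and T: "subspace T" and z: "z \<in> T"
    and e: "\<And>i. i \<in> I \<Longrightarrow> e i \<in> T" and "finite I"
  shows "B (\<Sum>i\<in>I. c i *\<^sub>R e i) z = (\<Sum>i\<in>I. c i * B (e i) z)"
  using \<open>finite I\<close> e
proof (induction I rule: finite_induct)
  case empty
  show ?case
    using sym_bilinear_on_scaleR_left[OF B z z, of 0] by simp
next
  case (insert i I)
  have "(\<Sum>i\<in>I. c i *\<^sub>R e i) \<in> T"
    using insert.prems by (intro subspace_sum[OF T] subspace_scale[OF T]) auto
  then show ?case
    using sym_bilinear_on_combination_left[OF B, of "e i" "\<Sum>i\<in>I. c i *\<^sub>R e i" z "c i" 1] insert z
    by simp
qed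

text \<open>The numbers \<open>B x (e i)\<close> serve as coordinates in place of the coefficients
  of \<open>x\<close> in the basis. The two differ only by the sign of \<open>B (e i) (e i)\<close>,
  so the form keeps its Minkowski shape, and later arguments need no basis expansions.\<close>

lemma lorentz_signature_on_coordinates:
  fixes B :: "'v::real_vector \<Rightarrow> 'v \<Rightarrow> real"
  assumes B: "sym_bilinear_on T B" and sig: "lorentz_signature_on TYPE('n::finite) T B"
  obtains e :: "'n::finite \<Rightarrow> 'v" and i0 where "subspace T" "\<And>i. e i \<in> T"
    "\<And>x. x \<in> T \<Longrightarrow> (\<And>i. B x (e i) = 0) \<Longrightarrow> x = 0"
    "\<And>x y. x \<in> T \<Longrightarrow> y \<in> T \<Longrightarrow>
       B x y = (\<Sum>i\<in>- {i0}. B x (e i) * B y (e i)) - B x (e i0) * B y (e i0)"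
proof -
  obtain e :: "'n \<Rightarrow> 'v" and i0 where e: "inj e" "span (range e) = T"
    "\<And>i j. B (e i) (e j) = (if i \<noteq> j then 0 else if i = i0 then -1 else 1)"
    using sig unfolding lorentz_signature_on_def by auto
  have T: "subspace T"
    using e(2) subspace_span by blast
  have eT: "e i \<in> T" for i
    using span_base[of "e i" "range e"] e(2) by simp
  \<comment> \<open>\<open>s i\<close> is the diagonal entry \<open>B (e i) (e i)\<close>. It is its
    own inverse, so multiplying by it turns a pairing with \<open>e i\<close> back into a
    coefficient.\<close>
  define s where "s i = (if i = i0 then -1 else 1 :: real)" for i
  have expand: "x = (\<Sum>i\<in>UNIV. (s i * B x (e i)) *\<^sub>R e i)" if "x \<in> T" for x
  proof -
    have "x \<in> span (range e)"
      using that e(2) by simp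
    then obtain u where "x = (\<Sum>w\<in>range e. u w *\<^sub>R w)"
      unfolding span_finite[OF finite_imageI[OF finite]] by blast
    then have x: "x = (\<Sum>i\<in>UNIV. u (e i) *\<^sub>R e i)"
      by (simp add: sum.reindex[OF e(1)])
    have "B x (e j) = u (e j) * s j" for j
    proof -
      have "B x (e j) = (\<Sum>i\<in>UNIV. u (e i) * B (e i) (e j))"
        unfolding x by (rule sym_bilinear_on_sum_left[OF B T eT eT]) auto
      also have "\<dots> = (\<Sum>i\<in>UNIV. if i = j then u (e j) * s j else 0)"
        by (intro sum.cong) (auto simp: e(3) s_def)
      finally show ?thesis by simp
    qed
    then have "s i * B x (e i) = u (e i)" for i
      by (simp add: s_def)
    with x show ?thesis by simp
  qed
  show thesis
  proof
    show "x = 0" if "x \<in> T" "\<And>i. B x (e i) = 0" for x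
      using expand[OF that(1)] that(2) by simp
    show "B x y = (\<Sum>i\<in>- {i0}. B x (e i) * B y (e i)) - B x (e i0) * B y (e i0)"
      if "x \<in> T" "y \<in> T" for x y
    proof -
      have "B x y = (\<Sum>i\<in>UNIV. s i * B x (e i) * B (e i) y)"
        by (subst expand[OF that(1)], rule sym_bilinear_on_sum_left[OF B T that(2) eT]) auto
      also have "\<dots> = (\<Sum>i\<in>UNIV. s i * (B x (e i) * B y (e i)))"
        using sym_bilinear_on_commute[OF B eT that(2)] by (simp add: mult.assoc)
      also have "\<dots> = s i0 * (B x (e i0) * B y (e i0))
          + (\<Sum>i\<in>UNIV - {i0}. s i * (B x (e i) * B y (e i)))"
        by (rule sum.remove) auto
      also have "(\<Sum>i\<in>UNIV - {i0}. s i * (B x (e i) * B y (e i)))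
          = (\<Sum>i\<in>- {i0}. B x (e i) * B y (e i))"
        by (rule sum.cong) (auto simp: s_def)
      finally show ?thesis by (simp add: s_def)
    qed
  qed (use T eT in auto)
qed

lemma lorentz_signature_on_nondegenerate:
  assumes B: "sym_bilinear_on T B" and sig: "lorentz_signature_on TYPE('n::finite) T B"
    and "w \<in> T" "\<And>y. y \<in> T \<Longrightarrow> B w y = 0"
  shows "w = 0"
  by (rule lorentz_signature_on_coordinates[OF B sig]) (use assms(3,4) in blast)

lemma lorentz_signature_on_subspace:
  assumes "lorentz_signature_on TYPE('n::finite) T B"
  shows "subspace T"
  using assms subspace_span unfolding lorentz_signature_on_def by blast

text \<open>Orthogonality equates the spatial product of \<open>v\<close> and \<open>z\<close> with
  the product \<open>a * b\<close> of their time components. Cauchy-Schwarz on the spatial parts and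
  \<open>P < a\<^sup>2\<close> then give
  \<open>a\<^sup>2 * b\<^sup>2 \<le> P * Q < a\<^sup>2 * Q\<close>, hence
  \<open>b\<^sup>2 < Q\<close>.\<close>

lemma timelike_orthogonal_spacelike:
  assumes B: "sym_bilinear_on T B" and sig: "lorentz_signature_on TYPE('n::finite) T B"
    and v: "v \<in> T" "B v v < 0" and z: "z \<in> T" "B v z = 0" "z \<noteq> 0"
  shows "B z z > 0"
proof -
  obtain e :: "'n \<Rightarrow> 'a" and i0 where "subspace T" "\<And>i. e i \<in> T" and
    nondeg: "\<And>x. x \<in> T \<Longrightarrow> (\<And>i. B x (e i) = 0) \<Longrightarrow> x = 0" and
    coord: "\<And>x y. x \<in> T \<Longrightarrow> y \<in> T \<Longrightarrow>
      B x y = (\<Sum>i\<in>- {i0}. B x (e i) * B y (e i)) - B x (e i0) * B y (e i0)"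
    using lorentz_signature_on_coordinates[OF B sig] by blast
  define a where "a = B v (e i0)"
  define b where "b = B z (e i0)"
  define P where "P = (\<Sum>i\<in>- {i0}. (B v (e i))\<^sup>2)"
  define Q where "Q = (\<Sum>i\<in>- {i0}. (B z (e i))\<^sup>2)"
  have vv: "P < a\<^sup>2"
    using v(2) coord[OF v(1) v(1)] by (simp add: P_def a_def power2_eq_square)
  have zz: "B z z = Q - b\<^sup>2"
    using coord[OF z(1) z(1)] by (simp add: Q_def b_def power2_eq_square)
  have vz: "(\<Sum>i\<in>- {i0}. B v (e i) * B z (e i)) = a * b"
    using coord[OF v(1) z(1)] z(2) by (simp add: a_def b_def)
  have CS: "(a * b)\<^sup>2 \<le> P * Q"
    using Cauchy_Schwarz_ineq_sum[of "\<lambda>i. B v (e i)" "\<lambda>i. B z (e i)" "- {i0}"]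
    unfolding vz P_def Q_def .
  have P0: "P \<ge> 0" and Q0: "Q \<ge> 0"
    unfolding P_def Q_def by (simp_all add: sum_nonneg)
  have a0: "a\<^sup>2 > 0"
    using vv P0 by linarith
  \<comment> \<open>Needed for strictness. If \<open>Q = 0\<close>, all spatial components of
    \<open>z\<close> vanish, and \<open>CS\<close> with \<open>a\<close> nonzero forces its time
    component to vanish too, so \<open>z\<close> would be zero.\<close>
  have "Q > 0"
  proof (rule ccontr)
    assume "\<not> Q > 0"
    then have Qz: "Q = 0" using Q0 by simp
    then have "\<forall>i\<in>- {i0}. B z (e i) = 0"
      unfolding Q_def by (subst (asm) sum_nonneg_eq_0_iff) auto
    moreover have "B z (e i0) = 0"
      using CS Qz a0 by (simp add: b_def)
    ultimately have "B z (e i) = 0" for i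
      by (cases "i = i0") auto
    then show False
      using nondeg z(1,3) by blast
  qed
  then have "P * Q < a\<^sup>2 * Q"
    using vv by simp
  with CS have "a\<^sup>2 * b\<^sup>2 < a\<^sup>2 * Q"
    by (simp add: power_mult_distrib)
  then show ?thesis
    using a0 zz by simp
qed

text \<open>The argument lives in a single tangent space, so it is isolated as linear algebra. Here
  \<open>w\<close> witnesses degeneracy of the deformed form, and \<open>y\<close> witnesses that
  \<open>x\<close> lies outside its radical.\<close>

lemma degenerate_timelike_deformation_positive:
  assumes B: "sym_bilinear_on T B" and sig: "lorentz_signature_on TYPE('n::finite) T B"
    and v: "v \<in> T" "B v v = -1"
    and w: "w \<in> T" "w \<noteq> 0" "\<And>y. y \<in> T \<Longrightarrow> B w y + c * (B v w * B v y) = 0"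
    and x: "x \<in> T" and y: "y \<in> T" "B x y + c * (B v x * B v y) \<noteq> 0"
  shows "B x x + c * (B v x * B v x) > 0"
proof -
  have "B v w \<noteq> 0"
    using lorentz_signature_on_nondegenerate[OF B sig w(1)] w(2,3) by fastforce
  moreover have "(1 - c) * B v w = 0"
    using w(3)[OF v(1)] v sym_bilinear_on_commute[OF B w(1) v(1)] by (simp add: algebra_simps)
  ultimately have c: "c = 1" by simp
  have vx: "B x v = B v x"
    using sym_bilinear_on_commute[OF B x v(1)] .
  define z where "z = 1 *\<^sub>R x + B v x *\<^sub>R v"
  have zT: "z \<in> T"
    unfolding z_def using lorentz_signature_on_subspace[OF sig] x v(1)
    by (intro subspace_add subspace_scale)
  have zl: "B z u = B x u + B v x * B v u" if "u \<in> T" for u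
    using sym_bilinear_on_combination_left[OF B x v(1) that, of 1 "B v x"] unfolding z_def by simp
  have zv: "B v z = 0"
    using zl[OF v(1)] vx v(2) sym_bilinear_on_commute[OF B zT v(1)] by simp
  have "B z z = B x z"
    using zl[OF zT] zv by simp
  also have "\<dots> = B x x + B v x * B v x"
    using zl[OF x] sym_bilinear_on_commute[OF B x zT] by simp
  finally have zz: "B z z = B x x + B v x * B v x" .
  \<comment> \<open>With \<open>c = 1\<close>, \<open>zl\<close> identifies \<open>B z y\<close>
    with the deformed pairing of \<open>x\<close> and \<open>y\<close>, which is nonzero; so
    \<open>z\<close> cannot be zero.\<close>
  have "B 0 y = 0"
    using sym_bilinear_on_scaleR_left[OF B x y(1), of 0] by simp
  then have "z \<noteq> 0"
    using zl[OF y(1)] y(2) c by auto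
  then show ?thesis
    using timelike_orthogonal_spacelike[OF B sig v(1) _ zT zv] v(2) zz c by simp
qed

theorem theorem1p7:
  fixes X :: "'a topology"
    and A :: "('a, 'n::finite) chart set"
    and g :: "'a tensor2"
    and L :: "'a \<Rightarrow> 'a tvec set"
    and f :: "'a \<Rightarrow> real"
    and q :: 'a
  assumes "CARD('n) \<ge> 2"
    and "lorentzian_manifold X A g"
    and "line_element_field X A L"
    and "\<forall>p\<in>topspace X. \<forall>v\<in>L p. g p v v = -1"
    and "smooth_fun X A f"
    and "q \<in> degeneracy_locus X A (modified_metric g f L)"
  shows "\<forall>x\<in>tangent_space X A q. x \<notin> Rad X A (modified_metric g f L) q \<longrightarrow>
           modified_metric g f L q x x > 0"
proof (intro ballI impI)
  fix x
  assume x: "x \<in> tangent_space X A q" "x \<notin> Rad X A (modified_metric g f L) q"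
  let ?T = "tangent_space X A q"
  have q: "q \<in> topspace X" and "degenerate_at X A (modified_metric g f L) q"
    using assms(6) unfolding degeneracy_locus_def by auto
  then obtain w where w: "w \<in> ?T" "w \<noteq> 0" "\<And>y. y \<in> ?T \<Longrightarrow> modified_metric g f L q w y = 0"
    unfolding degenerate_at_def by blast
  obtain y where y: "y \<in> ?T" "modified_metric g f L q x y \<noteq> 0"
    using x unfolding Rad_def by blast
  obtain v where v: "v \<in> ?T" "v \<in> L q"
    using assms(3) q unfolding line_element_field_def by blast
  have g: "lorentzian_metric X A g"
    using assms(2) unfolding lorentzian_manifold_def by blast
  then have B: "sym_bilinear_on ?T (g q)" and sig: "lorentz_signature_on TYPE('n) ?T (g q)"
    using q unfolding lorentzian_metric_def by auto
  \<comment> \<open>The choice operator in \<open>flat_square\<close> may pick either sign;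
    \<open>flat_square_eq\<close> replaces its value by the fixed representative
    \<open>v\<close>.\<close>
  have m: "modified_metric g f L q a b = g q a b + f q * (g q v a * g q v b)"
    if "a \<in> ?T" "b \<in> ?T" for a b
    unfolding modified_metric_def using flat_square_eq[OF g assms(3) q v(2) that] by simp
  show "modified_metric g f L q x x > 0"
    unfolding m[OF x(1) x(1)]
  proof (rule degenerate_timelike_deformation_positive[OF B sig v(1) _ w(1,2) _ x(1) y(1)])
    show "g q v v = -1"
      using assms(4) q v(2) by blast
  qed (use m w y x(1) in auto)
qed

end
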